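(* Let $G$ be a finitely generated infinite group which is not finitely presented (i.e. admits no finite presentation), let $A$ be a finite generating set of $G$, and let $S=A\cup A^{-1}$. Then $G$ does not admit a quasigeodesic normal form satisfying the $f(n)$-fellow traveler property; that is, for no function $f\in\mathcal F$ with $f\ll\mathfrak i$ does there exist a quasigeodesic normal form $L\subseteq S^*$ of $G$ satisfying the $f(n)$-fellow traveler property.
   Context: Setting. $A=\{a_1,\dots,a_m\}$ is a finite set of symbols representing elements generating $G$; distinct symbols may represent equal elements and some may represent the identity $e$. $A^{-1}$ is the set of formal inverses and $S=A\cup A^{-1}$. $S^*$ is the set of finite words over $S$, $|w|$ is the length of $w$, and $\pi:S^*\to G$ is the canonical projection (evaluation) map. $d_A(g_1,g_2)$ is the length of a shortest word $u\in S^*$ with $\pi(u)=g_1^{-1}g_2$, and $d_A(g)=d_A(e,g)$. Normal form. A language $L\subseteq S^*$ defines a normal form of $G$ if the restriction $\pi|_L:L\to G$ is a bijection. Quasigeodesic. A normal form $L$ is quasigeodesic if there is a constant $C>0$ such that $|w|\leqslant C(d_A(\pi(w))+1)$ for every $w\in L$. Functions. $\mathbb N$ includes $0$; $[N,+\infty)=\{n\in\mathbb N: n\geqslant N\}$; $\mathbb R_+=\{x\in\mathbb R: x\geqslant 0\}$. $\mathcal F$ is the set of all nondecreasing functions $[N,+\infty)\to\mathbb R_+$, for any $N\in\mathbb N$. For $f,h\in\mathcal F$, $h\preceq f$ means there exist positive integers $K,M$ and a nonnegative integer $N$ such that $h(n)\leqslant Kf(Mn)$ for all $n\in[N,+\infty)$.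 $h\ll f$ means there is an unbounded $t\in\mathcal F$ with $ht\preceq f$ (pointwise product on the common domain). $\mathfrak i(n)=n$. Fellow traveler property. For a word $w$ and $t\in\mathbb N$, $w(t)$ is the prefix of $w$ of length $t$ if $t\leqslant|w|$, and $w(t)=w$ if $t>|w|$. For a normal form $L$ put $$s(n)=\max\{d_A(\pi(w_1(t)),\pi(w_2(t))) : t\in\mathbb N,\ t\leqslant n,\ w_1,w_2\in L,\ a\in A,\ \pi(w_1)a=\pi(w_2)\}.$$ For $f\in\mathcal F$ with $f\ll\mathfrak i$, $L$ satisfies the $f(n)$-fellow traveler property if $s\preceq f$. *)

theory Defs
  imports Complex_Main "HOL-Algebra.Coset" "HOL-Algebra.Generated_Groups"
begin

section \<open>Words\<close>

datatype 's letter = Pos 's | Neg 's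

primrec flip :: "'s letter \<Rightarrow> 's letter" where
  "flip (Pos x) = Neg x"
| "flip (Neg x) = Pos x"

definition letters :: "'s set \<Rightarrow> 's letter set" where
  "letters A = Pos ` A \<union> Neg ` A"

abbreviation words :: "'s set \<Rightarrow> 's letter list set" where
  "words A \<equiv> lists (letters A)"


section \<open>Finite presentations\<close>

inductive_set cancel :: "'s set \<Rightarrow> ('s letter list \<times> 's letter list) set" for X where
  "u \<in> words X \<Longrightarrow> v \<in> words X \<Longrightarrow> x \<in> letters X \<Longrightarrow>
     (u @ [x, flip x] @ v, u @ v) \<in> cancel X"

definition free_eq :: "'s set \<Rightarrow> ('s letter list \<times> 's letter list) set" where
  "free_eq X = {(u, v). u \<in> words X \<and> v \<in> words X \<and> (u, v) \<in> (cancel X \<union> (cancel X)\<inverse>)\<^sup>*}"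

definition free_group :: "'s set \<Rightarrow> 's letter list set monoid" where
  "free_group X =
     \<lparr>carrier = words X // free_eq X,
      mult = (\<lambda>P Q. \<Union>p\<in>P. \<Union>q\<in>Q. free_eq X `` {p @ q}),
      one = free_eq X `` {[]}\<rparr>"

definition normal_closure :: "('g, 'm) monoid_scheme \<Rightarrow> 'g set \<Rightarrow> 'g set" where
  "normal_closure G R = \<Inter>{N. N \<lhd> G \<and> R \<subseteq> N}"

text \<open>Generators are taken among the natural numbers. This loses no generality: only the
  cardinality of the finite set of generators matters.\<close>

definition finitely_presented :: "('g, 'm) monoid_scheme \<Rightarrow> bool" where
  "finitely_presented G \<longleftrightarrow>
     (\<exists>(X :: nat set) R. finite X \<and> finite R \<and> R \<subseteq> carrier (free_group X) \<and>
        G \<cong> free_group X Mod normal_closure (free_group X) R)"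


section \<open>Evaluation of words and the word metric\<close>

text \<open>A set \<open>A\<close> of symbols comes with a map \<open>\<epsilon>\<close> sending a symbol to the element it
  represents. The map need not be injective and may take the value \<open>\<one>\<close>.\<close>

primrec letter_val :: "('g, 'm) monoid_scheme \<Rightarrow> ('s \<Rightarrow> 'g) \<Rightarrow> 's letter \<Rightarrow> 'g" where
  "letter_val G \<epsilon> (Pos a) = \<epsilon> a"
| "letter_val G \<epsilon> (Neg a) = inv\<^bsub>G\<^esub> \<epsilon> a"

definition word_val :: "('g, 'm) monoid_scheme \<Rightarrow> ('s \<Rightarrow> 'g) \<Rightarrow> 's letter list \<Rightarrow> 'g" where
  "word_val G \<epsilon> w = foldr (\<lambda>l g. letter_val G \<epsilon> l \<otimes>\<^bsub>G\<^esub> g) w \<one>\<^bsub>G\<^esub>"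

definition word_dist ::
  "('g, 'm) monoid_scheme \<Rightarrow> ('s \<Rightarrow> 'g) \<Rightarrow> 's set \<Rightarrow> 'g \<Rightarrow> 'g \<Rightarrow> nat" where
  "word_dist G \<epsilon> A g h =
     (LEAST n. \<exists>u\<in>words A. length u = n \<and> word_val G \<epsilon> u = inv\<^bsub>G\<^esub> g \<otimes>\<^bsub>G\<^esub> h)"


section \<open>Normal forms\<close>

definition normal_form ::
  "('g, 'm) monoid_scheme \<Rightarrow> ('s \<Rightarrow> 'g) \<Rightarrow> 's set \<Rightarrow> 's letter list set \<Rightarrow> bool" where
  "normal_form G \<epsilon> A L \<longleftrightarrow> L \<subseteq> words A \<and> bij_betw (word_val G \<epsilon>) L (carrier G)"

definition quasigeodesic ::
  "('g, 'm) monoid_scheme \<Rightarrow> ('s \<Rightarrow> 'g) \<Rightarrow> 's set \<Rightarrow> 's letter list set \<Rightarrow> bool" where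
  "quasigeodesic G \<epsilon> A L \<longleftrightarrow>
     (\<exists>C::real. C > 0 \<and>
        (\<forall>w\<in>L. real (length w) \<le> C * (real (word_dist G \<epsilon> A \<one>\<^bsub>G\<^esub> (word_val G \<epsilon> w)) + 1)))"


section \<open>Comparison of growth\<close>

text \<open>A function on \<open>[N,\<infinity>)\<close> is represented by any of its total extensions. The values below
  \<open>N\<close> are irrelevant, because \<open>growth_le\<close> and \<open>unbounded\<close> are insensitive to changing
  finitely many values.\<close>

definition growth_functions :: "(nat \<Rightarrow> real) set" where
  "growth_functions = {f. \<exists>N. mono_on {N..} f \<and> (\<forall>n\<ge>N. 0 \<le> f n)}"

definition growth_le :: "(nat \<Rightarrow> real) \<Rightarrow> (nat \<Rightarrow> real) \<Rightarrow> bool" (infix "\<preceq>" 50) where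
  "h \<preceq> f \<longleftrightarrow>
     (\<exists>(K::nat) (M::nat) (N::nat). K > 0 \<and> M > 0 \<and> (\<forall>n\<ge>N. h n \<le> real K * f (M * n)))"

definition unbounded :: "(nat \<Rightarrow> real) \<Rightarrow> bool" where
  "unbounded t \<longleftrightarrow> \<not> bdd_above (range t)"

definition growth_less :: "(nat \<Rightarrow> real) \<Rightarrow> (nat \<Rightarrow> real) \<Rightarrow> bool" (infix "\<lless>" 50) where
  "h \<lless> f \<longleftrightarrow> (\<exists>t\<in>growth_functions. unbounded t \<and> (\<lambda>n. h n * t n) \<preceq> f)"

lemma growth_le_cong:
  assumes "\<forall>n\<ge>k. h n = h' n" and "\<forall>n\<ge>k. f n = f' n"
  shows "h \<preceq> f \<longleftrightarrow> h' \<preceq> f'"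
proof -
  have "h' \<preceq> f'" if "h \<preceq> f" and h: "\<forall>n\<ge>k. h n = h' n" and f: "\<forall>n\<ge>k. f n = f' n"
    for h h' f f' :: "nat \<Rightarrow> real"
  proof -
    obtain K M N where "K > 0" "M > 0" and le: "\<forall>n\<ge>N. h n \<le> real K * f (M * n)"
      using \<open>h \<preceq> f\<close> unfolding growth_le_def by blast
    have "h' n \<le> real K * f' (M * n)" if "n \<ge> max N k" for n
    proof -
      have "n \<le> M * n"
        using \<open>M > 0\<close> by simp
      then have "k \<le> M * n"
        using that by linarith
      then show ?thesis
        using le h f that by (metis max.bounded_iff)
    qed
    then show ?thesis
      using \<open>K > 0\<close> \<open>M > 0\<close> unfolding growth_le_def by blast
  qed
  from this[of h f h' f'] this[of h' f' h f] assms show ?thesis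
    by auto
qed

lemma unbounded_cong:
  assumes "\<forall>n\<ge>k. t n = t' n"
  shows "unbounded t \<longleftrightarrow> unbounded t'"
proof -
  have "(UNIV :: nat set) = {..<k} \<union> {k..}"
    by auto
  then have "range f = f ` {..<k} \<union> f ` {k..}" for f :: "nat \<Rightarrow> real"
    by (metis image_Un)
  then have "bdd_above (range f) \<longleftrightarrow> bdd_above (f ` {k..})" for f :: "nat \<Rightarrow> real"
    by simp
  moreover have "t ` {k..} = t' ` {k..}"
    using assms by (auto intro!: image_cong)
  ultimately show ?thesis
    unfolding unbounded_def by simp
qed


section \<open>The fellow traveler property\<close>

text \<open>The prefix \<open>w(t)\<close> is \<^term>\<open>take t w\<close>, which is \<open>w\<close> if \<open>t\<close> exceeds the length of \<open>w\<close>.\<close>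

definition fellow_dists ::
  "('g, 'm) monoid_scheme \<Rightarrow> ('s \<Rightarrow> 'g) \<Rightarrow> 's set \<Rightarrow> 's letter list set \<Rightarrow> nat \<Rightarrow> nat set" where
  "fellow_dists G \<epsilon> A L n =
     {word_dist G \<epsilon> A (word_val G \<epsilon> (take t w\<^sub>1)) (word_val G \<epsilon> (take t w\<^sub>2)) | t w\<^sub>1 w\<^sub>2 a.
        t \<le> n \<and> w\<^sub>1 \<in> L \<and> w\<^sub>2 \<in> L \<and> a \<in> A \<and> word_val G \<epsilon> w\<^sub>1 \<otimes>\<^bsub>G\<^esub> \<epsilon> a = word_val G \<epsilon> w\<^sub>2}"

definition fellow_fun ::
  "('g, 'm) monoid_scheme \<Rightarrow> ('s \<Rightarrow> 'g) \<Rightarrow> 's set \<Rightarrow> 's letter list set \<Rightarrow> nat \<Rightarrow> nat" where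
  "fellow_fun G \<epsilon> A L n = Max (fellow_dists G \<epsilon> A L n)"

definition fellow_traveler ::
  "('g, 'm) monoid_scheme \<Rightarrow> ('s \<Rightarrow> 'g) \<Rightarrow> 's set \<Rightarrow> 's letter list set \<Rightarrow> (nat \<Rightarrow> real) \<Rightarrow> bool" where
  "fellow_traveler G \<epsilon> A L f \<longleftrightarrow> (\<lambda>n. real (fellow_fun G \<epsilon> A L n)) \<preceq> f"


section \<open>Well-definedness\<close>

lemma flip_flip [simp]: "flip (flip x) = x"
  by (cases x) auto

lemma flip_in_letters [simp]: "flip x \<in> letters X \<longleftrightarrow> x \<in> letters X"
  by (cases x) (auto simp: letters_def)

lemma words_rev_flip: "w \<in> words X \<Longrightarrow> rev (map flip w) \<in> words X"
  by auto

lemma equiv_free_eq: "equiv (words X) (free_eq X)"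
proof (rule equivI)
  show "free_eq X \<subseteq> words X \<times> words X"
    by (auto simp: free_eq_def)
  show "refl_on (words X) (free_eq X)"
    by (auto simp: refl_on_def free_eq_def)
  have "sym ((cancel X \<union> (cancel X)\<inverse>)\<^sup>*)"
    by (intro sym_rtrancl sym_Un_converse)
  then show "sym (free_eq X)"
    by (auto simp: free_eq_def sym_def)
  show "trans (free_eq X)"
    by (auto simp: free_eq_def intro!: transI)
qed

lemma cancel_context:
  assumes "(u, v) \<in> cancel X" "p \<in> words X" "q \<in> words X"
  shows "(p @ u @ q, p @ v @ q) \<in> cancel X"
  using assms(1)
proof cases
  case (1 u' v' x)
  then have "((p @ u') @ [x, flip x] @ (v' @ q), (p @ u') @ (v' @ q)) \<in> cancel X"
    using assms by (intro cancel.intros) auto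
  then show ?thesis
    using 1 by simp
qed

lemma free_eq_context:
  assumes "(u, v) \<in> free_eq X" "p \<in> words X" "q \<in> words X"
  shows "(p @ u @ q, p @ v @ q) \<in> free_eq X"
proof -
  have "(u, v) \<in> (cancel X \<union> (cancel X)\<inverse>)\<^sup>*"
    using assms by (auto simp: free_eq_def)
  then have "(p @ u @ q, p @ v @ q) \<in> (cancel X \<union> (cancel X)\<inverse>)\<^sup>*"
  proof induction
    case base
    show ?case by simp
  next
    case (step y z)
    then have "(p @ y @ q, p @ z @ q) \<in> cancel X \<union> (cancel X)\<inverse>"
      using cancel_context assms by blast
    with step.IH show ?case
      by (rule rtrancl_into_rtrancl)
  qed
  then show ?thesis
    using assms by (auto simp: free_eq_def)
qed

lemma free_eq_append:
  assumes "(u, u') \<in> free_eq X" "(v, v') \<in> free_eq X"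
  shows "(u @ v, u' @ v') \<in> free_eq X"
proof -
  have "u' \<in> words X" "v \<in> words X"
    using assms by (auto simp: free_eq_def)
  then have "(u @ v, u' @ v) \<in> free_eq X" "(u' @ v, u' @ v') \<in> free_eq X"
    using free_eq_context[OF assms(1), of "[]" v] free_eq_context[OF assms(2), of u' "[]"] by auto
  then show ?thesis
    using equiv_free_eq[of X] by (meson equivE transD)
qed

lemma free_group_mult:
  assumes "u \<in> words X" "v \<in> words X"
  shows "free_eq X `` {u} \<otimes>\<^bsub>free_group X\<^esub> free_eq X `` {v} = free_eq X `` {u @ v}"
proof -
  have "free_eq X `` {p @ q} = free_eq X `` {u @ v}"
    if "p \<in> free_eq X `` {u}" "q \<in> free_eq X `` {v}" for p q
    using that free_eq_append[of u p X v q] equiv_class_eq[OF equiv_free_eq] by force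
  moreover have "u \<in> free_eq X `` {u}" "v \<in> free_eq X `` {v}"
    using assms equiv_class_self[OF equiv_free_eq] by auto
  ultimately have "(\<Union>p\<in>free_eq X `` {u}. \<Union>q\<in>free_eq X `` {v}. free_eq X `` {p @ q}) =
      free_eq X `` {u @ v}"
    by blast
  then show ?thesis
    by (simp add: free_group_def)
qed

lemma free_eq_inverse:
  assumes "w \<in> words X"
  shows "(rev (map flip w) @ w, []) \<in> free_eq X"
  using assms
proof (induction w)
  case Nil
  show ?case by (simp add: free_eq_def)
next
  case (Cons x w)
  then have w: "w \<in> words X" and x: "x \<in> letters X"
    by auto
  have "(rev (map flip w) @ [flip x, flip (flip x)] @ w, rev (map flip w) @ w) \<in> cancel X"
    using w x words_rev_flip by (intro cancel.intros) auto
  moreover have "rev (map flip w) \<in> words X"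
    using w words_rev_flip by blast
  ultimately have "(rev (map flip (x # w)) @ x # w, rev (map flip w) @ w) \<in> free_eq X"
    using w x by (auto simp: free_eq_def)
  then show ?case
    using Cons.IH equiv_free_eq[of X] by (meson equivE transD)
qed

lemma group_free_group: "group (free_group X)"
proof (rule groupI)
  have carr: "carrier (free_group X) = (\<lambda>w. free_eq X `` {w}) ` words X"
    by (auto simp: free_group_def quotient_def)
  have one: "\<one>\<^bsub>free_group X\<^esub> = free_eq X `` {[]}"
    by (simp add: free_group_def)
  have elem: "\<exists>w\<in>words X. x = free_eq X `` {w}" if "x \<in> carrier (free_group X)" for x
    using that unfolding carr by blast
  have elemI: "free_eq X `` {w} \<in> carrier (free_group X)" if "w \<in> words X" for w
    using that unfolding carr by blast
  show "x \<otimes>\<^bsub>free_group X\<^esub> y \<in> carrier (free_group X)"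
    if xy: "x \<in> carrier (free_group X)" "y \<in> carrier (free_group X)" for x y
  proof -
    obtain u v where "u \<in> words X" "x = free_eq X `` {u}" "v \<in> words X" "y = free_eq X `` {v}"
      using elem[OF xy(1)] elem[OF xy(2)] by blast
    then show ?thesis
      using elemI[of "u @ v"] free_group_mult[of u X v] by simp
  qed
  show "\<one>\<^bsub>free_group X\<^esub> \<in> carrier (free_group X)"
    unfolding one by (rule elemI) simp
  show "(x \<otimes>\<^bsub>free_group X\<^esub> y) \<otimes>\<^bsub>free_group X\<^esub> z = x \<otimes>\<^bsub>free_group X\<^esub> (y \<otimes>\<^bsub>free_group X\<^esub> z)"
    if xyz: "x \<in> carrier (free_group X)" "y \<in> carrier (free_group X)" "z \<in> carrier (free_group X)"
    for x y z
  proof -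
    obtain u v w where "u \<in> words X" "x = free_eq X `` {u}" "v \<in> words X" "y = free_eq X `` {v}"
      "w \<in> words X" "z = free_eq X `` {w}"
      using elem[OF xyz(1)] elem[OF xyz(2)] elem[OF xyz(3)] by blast
    then show ?thesis
      using free_group_mult[of u X v] free_group_mult[of v X w]
        free_group_mult[of "u @ v" X w] free_group_mult[of u X "v @ w"] by simp
  qed
  show "\<one>\<^bsub>free_group X\<^esub> \<otimes>\<^bsub>free_group X\<^esub> x = x" if x: "x \<in> carrier (free_group X)" for x
  proof -
    obtain w where "w \<in> words X" "x = free_eq X `` {w}"
      using elem[OF x] by blast
    then show ?thesis
      unfolding one using free_group_mult[of "[]" X w] by simp
  qed
  show "\<exists>y\<in>carrier (free_group X). y \<otimes>\<^bsub>free_group X\<^esub> x = \<one>\<^bsub>free_group X\<^esub>"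
    if "x \<in> carrier (free_group X)" for x
  proof -
    obtain w where w: "w \<in> words X" "x = free_eq X `` {w}"
      using \<open>x \<in> carrier (free_group X)\<close> unfolding carr by blast
    have "free_eq X `` {rev (map flip w)} \<otimes>\<^bsub>free_group X\<^esub> x = \<one>\<^bsub>free_group X\<^esub>"
      using free_group_mult[OF words_rev_flip] free_eq_inverse equiv_class_eq[OF equiv_free_eq] w
      unfolding one by metis
    then show ?thesis
      unfolding carr using words_rev_flip[OF w(1)] by blast
  qed
qed

lemma (in group) normal_closure_normal:
  assumes "R \<subseteq> carrier G"
  shows "normal_closure G R \<lhd> G"
proof -
  have "carrier G \<lhd> G"
    by (rule normal_invI) (auto simp: subgroup_self)
  then have ne: "{N. N \<lhd> G \<and> R \<subseteq> N} \<noteq> {}"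
    using assms by auto
  show ?thesis
    unfolding normal_closure_def
  proof (rule normal_invI)
    show "subgroup (\<Inter>{N. N \<lhd> G \<and> R \<subseteq> N}) G"
      using ne by (intro subgroups_Inter) (auto dest: normal_imp_subgroup)
  qed (auto dest: normal.inv_op_closed2)
qed

context group
begin

context
  fixes A :: "'s set" and \<epsilon> :: "'s \<Rightarrow> 'a"
  assumes \<epsilon>: "\<epsilon> ` A \<subseteq> carrier G"
begin

lemma letter_val_closed: "l \<in> letters A \<Longrightarrow> letter_val G \<epsilon> l \<in> carrier G"
  using \<epsilon> by (auto simp: letters_def)

lemma word_val_closed: "w \<in> words A \<Longrightarrow> word_val G \<epsilon> w \<in> carrier G"
  by (induction w) (auto simp: word_val_def letter_val_closed)

lemma word_val_append:
  "u \<in> words A \<Longrightarrow> v \<in> words A \<Longrightarrow> word_val G \<epsilon> (u @ v) = word_val G \<epsilon> u \<otimes> word_val G \<epsilon> v"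
proof (induction u)
  case Nil
  then show ?case
    using word_val_closed by (simp add: word_val_def)
next
  case (Cons x u)
  then show ?case
    using word_val_closed[of u] word_val_closed[of v] letter_val_closed[of x]
    by (auto simp: word_val_def m_assoc)
qed

lemma letter_val_flip: "l \<in> letters A \<Longrightarrow> letter_val G \<epsilon> (flip l) = inv letter_val G \<epsilon> l"
  using \<epsilon> by (auto simp: letters_def)

lemma word_val_rev_flip:
  "w \<in> words A \<Longrightarrow> word_val G \<epsilon> (rev (map flip w)) = inv word_val G \<epsilon> w"
proof (induction w)
  case Nil
  then show ?case by (simp add: word_val_def)
next
  case (Cons x w)
  then have x: "x \<in> letters A" and w: "w \<in> words A" by auto
  have "word_val G \<epsilon> (rev (map flip w) @ [flip x]) =
      word_val G \<epsilon> (rev (map flip w)) \<otimes> word_val G \<epsilon> [flip x]"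
    using x w words_rev_flip by (intro word_val_append) auto
  also have "\<dots> = inv word_val G \<epsilon> w \<otimes> inv letter_val G \<epsilon> x"
    using Cons.IH w x letter_val_closed[OF x] by (simp add: word_val_def letter_val_flip)
  also have "\<dots> = inv (letter_val G \<epsilon> x \<otimes> word_val G \<epsilon> w)"
    using letter_val_closed[OF x] word_val_closed[OF w] by (simp add: inv_mult_group)
  finally show ?case
    by (simp add: word_val_def)
qed

lemma word_val_surj:
  assumes "generate G (\<epsilon> ` A) = carrier G" "g \<in> carrier G"
  shows "\<exists>u\<in>words A. word_val G \<epsilon> u = g"
proof -
  have "g \<in> generate G (\<epsilon> ` A)"
    using assms by simp
  then show ?thesis
  proof induction
    case one
    show ?case by (rule bexI[of _ "[]"]) (auto simp: word_val_def)
  next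
    case (incl h)
    then obtain a where "a \<in> A" "h = \<epsilon> a" by auto
    then show ?case
      using \<epsilon> by (intro bexI[of _ "[Pos a]"]) (auto simp: word_val_def letters_def)
  next
    case (inv h)
    then obtain a where "a \<in> A" "h = \<epsilon> a" by auto
    then show ?case
      using \<epsilon> by (intro bexI[of _ "[Neg a]"]) (auto simp: word_val_def letters_def)
  next
    case (eng g h)
    then obtain u v where "u \<in> words A" "v \<in> words A" "word_val G \<epsilon> u = g" "word_val G \<epsilon> v = h"
      by blast
    then show ?case
      using word_val_append by (intro bexI[of _ "u @ v"]) auto
  qed
qed

text \<open>The maximum defining \<^const>\<open>fellow_fun\<close> is attained.\<close>

lemma fellow_dists_finite:
  assumes "L \<subseteq> words A"
  shows "finite (fellow_dists G \<epsilon> A L n)"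
proof (rule finite_subset)
  show "fellow_dists G \<epsilon> A L n \<subseteq> {..2 * n}"
  proof
    fix d
    assume "d \<in> fellow_dists G \<epsilon> A L n"
    then obtain t w\<^sub>1 w\<^sub>2 where t: "t \<le> n" and w: "w\<^sub>1 \<in> L" "w\<^sub>2 \<in> L"
      and d: "d = word_dist G \<epsilon> A (word_val G \<epsilon> (take t w\<^sub>1)) (word_val G \<epsilon> (take t w\<^sub>2))"
      unfolding fellow_dists_def by blast
    define u where "u = rev (map flip (take t w\<^sub>1)) @ take t w\<^sub>2"
    have tk: "take t w\<^sub>1 \<in> words A" "take t w\<^sub>2 \<in> words A"
      using w assms by (auto dest: in_set_takeD)
    then have "u \<in> words A"
      unfolding u_def using words_rev_flip by auto
    moreover have "word_val G \<epsilon> u =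
        inv word_val G \<epsilon> (take t w\<^sub>1) \<otimes> word_val G \<epsilon> (take t w\<^sub>2)"
      unfolding u_def using tk word_val_append words_rev_flip word_val_rev_flip by metis
    ultimately have "d \<le> length u"
      unfolding d word_dist_def by (intro Least_le) auto
    then show "d \<in> {..2 * n}"
      using t by (auto simp: u_def)
  qed
qed simp

lemma fellow_dists_nonempty:
  assumes "normal_form G \<epsilon> A L" "A \<noteq> {}"
  shows "fellow_dists G \<epsilon> A L n \<noteq> {}"
proof -
  obtain a where a: "a \<in> A"
    using assms by blast
  have img: "word_val G \<epsilon> ` L = carrier G"
    using assms by (auto simp: normal_form_def bij_betw_def)
  then obtain w\<^sub>1 where w1: "w\<^sub>1 \<in> L"
    using one_closed by blast
  then have "word_val G \<epsilon> w\<^sub>1 \<otimes> \<epsilon> a \<in> word_val G \<epsilon> ` L"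
    using a img \<epsilon> by blast
  then obtain w\<^sub>2 where w2: "w\<^sub>2 \<in> L" "word_val G \<epsilon> w\<^sub>1 \<otimes> \<epsilon> a = word_val G \<epsilon> w\<^sub>2"
    by blast
  have "word_dist G \<epsilon> A (word_val G \<epsilon> (take 0 w\<^sub>1)) (word_val G \<epsilon> (take 0 w\<^sub>2))
      \<in> fellow_dists G \<epsilon> A L n"
    unfolding fellow_dists_def using a w1 w2 by blast
  then show ?thesis
    by blast
qed

end

end

end

theory Submission
  imports Defs
begin

text \<open>
  If \<open>L\<close> is a quasigeodesic normal form whose fellow traveler function \<open>s\<close> is sublinear, then
  every sufficiently long relation of \<open>G\<close> follows from strictly shorter ones, so that finitely
  many relations define \<open>G\<close>.

  Let \<open>w = x\<^sub>1 \<dots> x\<^sub>n\<close> be a word representing the identity, and let \<open>u\<^sub>i \<in> L\<close> be the normal form of its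
  prefix of length \<open>i\<close>. Cone off the loop \<open>w\<close> from the identity along the words \<open>u\<^sub>i\<close>: it becomes a
  product of conjugates of the cells \<open>u\<^sub>i\<^sub>-\<^sub>1 x\<^sub>i u\<^sub>i\<inverse>\<close>. The two long sides of a cell are normal forms of
  neighbouring elements, so at each time \<open>t\<close> their prefixes are joined by a rung, a word of length
  at most \<open>s(m)\<close>, where \<open>m\<close> bounds the lengths of the \<open>u\<^sub>i\<close>. The rungs cut the cell into loops of
  length at most \<open>2 s(m) + 2\<close>. As \<open>L\<close> is quasigeodesic, \<open>m\<close> can be taken linear in \<open>n\<close>, and
  sublinearity of \<open>s\<close> gives \<open>2 s(m) + 2 < n\<close> once \<open>n\<close> exceeds some \<open>N\<close>. By induction on \<open>n\<close>, all
  relations follow from those of length less than \<open>N\<close>. The normal form \<open>u\<^sub>0 = u\<^sub>n\<close> of the identity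
  may be a nonempty word, but it only conjugates \<open>w\<close>.

  ``Follows from'' is expressed semantically, without van Kampen diagrams: a relation of \<open>G\<close> follows
  from others if it holds in every group, with every choice of values for the symbols, in which
  those others hold. Thus \<open>fill_ladder\<close>, \<open>fill_cell\<close> and \<open>fill_relation\<close> compare the values of words in
  \<open>G\<close> and in an arbitrary second group \<open>H\<close>, and \<open>short_relations_suffice\<close> carries out the induction.
  For \<open>H\<close> the quotient of the free group by the normal closure of the short relations, this says
  that the kernel of the evaluation map is that normal closure (\<open>finitely_presentedI\<close>).
\<close>

section \<open>Sublinear growth\<close>

text \<open>Being nondecreasing and unbounded, the factor \<open>t\<close> with \<open>f t \<preceq> n\<close> eventually exceeds any
  constant \<open>B\<close>, and hence \<open>f\<close> eventually drops below any positive multiple of \<open>n\<close>. Rescaling the argument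
  costs only the factor \<open>M'\<close>, which \<open>B\<close> absorbs.\<close>
lemma sublinear_if_growth_less:
  assumes f: "f \<in> growth_functions" and less: "f \<lless> (\<lambda>n. real n)" and le: "s \<preceq> f"
    and c: "c > 0"
  shows "\<exists>N. \<forall>n\<ge>N. s n \<le> c * real n"
proof -
  obtain N0 where f0: "\<And>n. n \<ge> N0 \<Longrightarrow> 0 \<le> f n"
    using f unfolding growth_functions_def by auto
  obtain t K M N1 where t: "t \<in> growth_functions" "unbounded t"
    and ft: "\<And>n. n \<ge> N1 \<Longrightarrow> f n * t n \<le> real K * real (M * n)"
    using less unfolding growth_less_def growth_le_def by blast
  obtain N2 where tm: "mono_on {N2..} t"
    using t unfolding growth_functions_def by auto
  obtain K' M' N3 where M': "M' > 0" and s: "\<And>n. n \<ge> N3 \<Longrightarrow> s n \<le> real K' * f (M' * n)"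
    using le unfolding growth_le_def by blast
  \<comment> \<open>Chosen so that the composite constant \<open>K' K M M'\<close> of the two estimates equals \<open>(B - 1) c\<close>;
    the summand 1 makes \<open>B\<close> positive.\<close>
  define B where "B = real K' * real K * real M * real M' / c + 1"
  have "B > 0"
    using c by (auto simp: B_def intro!: add_nonneg_pos)
  obtain p where p: "p \<ge> N2" "t p > B"
  proof -
    have "\<not> bdd_above (t ` {N2..})"
    proof
      assume "bdd_above (t ` {N2..})"
      then have "bdd_above (t ` {..<N2} \<union> t ` {N2..})"
        by simp
      moreover have "t ` {..<N2} \<union> t ` {N2..} = range t"
        unfolding image_Un[symmetric] by (rule arg_cong[of _ _ "image t"]) auto
      ultimately show False
        using t(2) by (simp add: unbounded_def)
    qed
    then show ?thesis
      using that unfolding bdd_above_def by (metis atLeast_iff imageE linorder_not_le)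
  qed
  have "s n \<le> c * real n" if n: "n \<ge> Max {N0, N1, N2, N3, p}" for n
  proof -
    have ge: "n \<ge> N0" "n \<ge> N1" "n \<ge> N3" "n \<ge> p"
      using n by auto
    have "n \<le> M' * n"
      using M' by simp
    then have ge': "M' * n \<ge> N0" "M' * n \<ge> N1" "M' * n \<ge> p"
      using ge by linarith+
    have "B \<le> t (M' * n)"
      using tm ge' p unfolding mono_on_def by (smt (verit) atLeast_iff dual_order.trans)
    then have "f (M' * n) * B \<le> f (M' * n) * t (M' * n)"
      using f0 ge' by (intro mult_left_mono) auto
    also have "\<dots> \<le> real K * real (M * (M' * n))"
      using ft ge' by blast
    finally have "real K' * (f (M' * n) * B) \<le> real K' * (real K * real (M * (M' * n)))"
      by (intro mult_left_mono) auto
    also have "\<dots> = (B - 1) * c * real n"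
      using c by (simp add: B_def)
    also have "\<dots> \<le> B * (c * real n)"
      using c by (simp add: algebra_simps)
    finally have "B * (real K' * f (M' * n)) \<le> B * (c * real n)"
      by (simp add: mult_ac)
    then show ?thesis
      using s[OF ge(3)] \<open>B > 0\<close> by (smt (verit) mult_le_cancel_left_pos)
  qed
  then show ?thesis
    by blast
qed

section \<open>Filling relations with shorter relations\<close>

lemma take_in_words: "w \<in> words A \<Longrightarrow> take t w \<in> words A"
  by (auto dest: in_set_takeD)

lemma drop_in_words: "w \<in> words A \<Longrightarrow> drop t w \<in> words A"
  by (auto dest: in_set_dropD)

lemma (in group) word_val_letter:
  assumes "\<epsilon> ` A \<subseteq> carrier G" "x \<in> letters A"
  shows "word_val G \<epsilon> [x] = letter_val G \<epsilon> x"
  using letter_val_closed[OF assms] by (simp add: word_val_def)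

lemma (in group) word_dist_attained:
  assumes "\<epsilon> ` A \<subseteq> carrier G" "generate G (\<epsilon> ` A) = carrier G"
    and "g \<in> carrier G" "h \<in> carrier G"
  shows "\<exists>u\<in>words A. length u = word_dist G \<epsilon> A g h \<and> word_val G \<epsilon> u = inv g \<otimes> h"
  unfolding word_dist_def
  by (rule LeastI_ex) (use word_val_surj[OF assms(1,2), of "inv g \<otimes> h"] assms in auto)

definition short_relations_hold ::
  "('g, 'm) monoid_scheme \<Rightarrow> ('s \<Rightarrow> 'g) \<Rightarrow> ('h, 'n) monoid_scheme \<Rightarrow> ('s \<Rightarrow> 'h) \<Rightarrow>
     's set \<Rightarrow> nat \<Rightarrow> bool" where
  "short_relations_hold G \<epsilon> H \<delta> A n \<longleftrightarrow>
     (\<forall>w\<in>words A. length w < n \<longrightarrow> word_val G \<epsilon> w = \<one>\<^bsub>G\<^esub> \<longrightarrow> word_val H \<delta> w = \<one>\<^bsub>H\<^esub>)"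

locale two_marked_groups = G: group G + H: group H
  for G :: "('g, 'm) monoid_scheme" and H :: "('h, 'n) monoid_scheme" +
  fixes A :: "'s set" and \<epsilon> :: "'s \<Rightarrow> 'g" and \<delta> :: "'s \<Rightarrow> 'h"
  assumes \<epsilon>: "\<epsilon> ` A \<subseteq> carrier G" and \<delta>: "\<delta> ` A \<subseteq> carrier H"
begin

abbreviation "P \<equiv> word_val G \<epsilon>"
abbreviation "Q \<equiv> word_val H \<delta>"

lemmas P_closed = G.word_val_closed[OF \<epsilon>] and Q_closed = H.word_val_closed[OF \<delta>]
  and P_append = G.word_val_append[OF \<epsilon>] and Q_append = H.word_val_append[OF \<delta>]

text \<open>Two words of equal value form the loop \<open>u v\<inverse>\<close>. The fillings below split each loop into two paths
  with common endpoints in this way.\<close>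
lemma short_equations_hold:
  assumes short: "short_relations_hold G \<epsilon> H \<delta> A n"
    and uv: "u \<in> words A" "v \<in> words A" "length u + length v < n" and eq: "P u = P v"
  shows "Q u = Q v"
proof -
  let ?w = "u @ rev (map flip v)"
  have v': "rev (map flip v) \<in> words A"
    using uv words_rev_flip by blast
  have "P ?w = P u \<otimes>\<^bsub>G\<^esub> inv\<^bsub>G\<^esub> P v"
    using P_append[OF uv(1) v'] G.word_val_rev_flip[OF \<epsilon> uv(2)] by simp
  then have "P ?w = \<one>\<^bsub>G\<^esub>"
    using eq uv P_closed by simp
  moreover have "?w \<in> words A" "length ?w < n"
    using uv v' by auto
  ultimately have "Q ?w = \<one>\<^bsub>H\<^esub>"
    using short by (simp add: short_relations_hold_def)
  then have "Q u \<otimes>\<^bsub>H\<^esub> inv\<^bsub>H\<^esub> Q v = \<one>\<^bsub>H\<^esub>"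
    using Q_append[OF uv(1) v'] H.word_val_rev_flip[OF \<delta> uv(2)] by simp
  then have "inv\<^bsub>H\<^esub> (inv\<^bsub>H\<^esub> Q v) = Q u"
    using uv Q_closed by (intro H.inv_equality) auto
  then show ?thesis
    using uv Q_closed by simp
qed

text \<open>The words \<open>u\<close> and \<open>v\<close> are the sides of a ladder with rungs \<open>\<gamma> t\<close> of length at most \<open>k\<close>. Two
  neighbouring rungs together with the steps \<open>x\<close> and \<open>y\<close> of the two sides between them bound a loop
  of length at most \<open>2 k + 2\<close>. Its relation transfers to \<open>H\<close>, so induction on the height \<open>t\<close> glues
  these loops together.\<close>
lemma fill_ladder:
  assumes short: "short_relations_hold G \<epsilon> H \<delta> A n" and n: "2 * k + 2 < n"
    and uv: "u \<in> words A" "v \<in> words A"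
    and rung: "\<And>t. t \<le> m \<Longrightarrow> \<gamma> t \<in> words A" "\<And>t. t \<le> m \<Longrightarrow> length (\<gamma> t) \<le> k"
      "\<And>t. t \<le> m \<Longrightarrow> P (take t u) \<otimes>\<^bsub>G\<^esub> P (\<gamma> t) = P (take t v)"
  shows "t \<le> m \<Longrightarrow> Q (take t u) \<otimes>\<^bsub>H\<^esub> Q (\<gamma> t) = Q (take t v)"
proof (induction t)
  case 0
  have "P (\<gamma> 0) = P []"
    using rung(3)[of 0] rung(1)[of 0] P_closed by (simp add: word_val_def)
  then have "Q (\<gamma> 0) = Q []"
    using rung[of 0] n by (intro short_equations_hold[OF short]) auto
  then show ?case
    by (simp add: word_val_def)
next
  case (Suc t)
  then have t: "t \<le> m"
    by simp
  \<comment> \<open>The step is the empty word if the side has already ended, as sides may differ in length.\<close>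
  define x where "x = take 1 (drop t u)"
  define y where "y = take 1 (drop t v)"
  have split: "take (Suc t) u = take t u @ x" "take (Suc t) v = take t v @ y"
    using take_add[of t 1] by (simp_all add: x_def y_def)
  have w: "take t u \<in> words A" "take t v \<in> words A" "x \<in> words A" "y \<in> words A"
    "\<gamma> t \<in> words A" "\<gamma> (Suc t) \<in> words A"
    unfolding x_def y_def
    using take_in_words drop_in_words uv rung(1)[OF t] rung(1)[OF Suc.prems] by blast+
  note P = w[THEN P_closed] and Q = w[THEN Q_closed]
  have "P (take t u) \<otimes>\<^bsub>G\<^esub> (P x \<otimes>\<^bsub>G\<^esub> P (\<gamma> (Suc t))) = P (take t u) \<otimes>\<^bsub>G\<^esub> (P (\<gamma> t) \<otimes>\<^bsub>G\<^esub> P y)"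
    using rung(3)[OF Suc.prems] rung(3)[OF t] P w by (simp add: split P_append flip: G.m_assoc)
  then have "P (x @ \<gamma> (Suc t)) = P (\<gamma> t @ y)"
    using P w by (simp add: P_append)
  moreover have "length (x @ \<gamma> (Suc t)) + length (\<gamma> t @ y) < n"
    using rung(2)[OF Suc.prems] rung(2)[OF t] n by (simp add: x_def y_def)
  ultimately have "Q (x @ \<gamma> (Suc t)) = Q (\<gamma> t @ y)"
    using w by (intro short_equations_hold[OF short]) auto
  then have "Q x \<otimes>\<^bsub>H\<^esub> Q (\<gamma> (Suc t)) = Q (\<gamma> t) \<otimes>\<^bsub>H\<^esub> Q y"
    using w by (simp add: Q_append)
  then have "Q (take (Suc t) u) \<otimes>\<^bsub>H\<^esub> Q (\<gamma> (Suc t)) = Q (take t u) \<otimes>\<^bsub>H\<^esub> (Q (\<gamma> t) \<otimes>\<^bsub>H\<^esub> Q y)"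
    using Q w by (simp add: split Q_append H.m_assoc)
  also have "\<dots> = Q (take (Suc t) v)"
    using Suc.IH[OF t] Q w by (simp add: split Q_append flip: H.m_assoc)
  finally show ?case .
qed

context
  fixes L and n m :: nat
  assumes gen: "generate G (\<epsilon> ` A) = carrier G"
    and L: "normal_form G \<epsilon> A L"
    and short: "short_relations_hold G \<epsilon> H \<delta> A n"
    and n: "2 * fellow_fun G \<epsilon> A L m + 2 < n"
begin

lemma L_words: "u \<in> L \<Longrightarrow> u \<in> words A"
  using L by (auto simp: normal_form_def)

text \<open>The top rung joins \<open>u\<close> to \<open>v\<close>, as does the symbol \<open>a\<close>. These two short words have equal values
  in \<open>G\<close>, hence in \<open>H\<close>.\<close>
lemma fill_generator_cell:
  assumes uv: "u \<in> L" "v \<in> L" "length u \<le> m" "length v \<le> m" and a: "a \<in> A"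
    and eq: "P u \<otimes>\<^bsub>G\<^esub> \<epsilon> a = P v"
  shows "Q u \<otimes>\<^bsub>H\<^esub> \<delta> a = Q v"
proof -
  let ?k = "fellow_fun G \<epsilon> A L m"
  have w: "u \<in> words A" "v \<in> words A"
    using uv L_words by auto
  have "\<exists>g\<in>words A. length g \<le> ?k \<and> P (take t u) \<otimes>\<^bsub>G\<^esub> P g = P (take t v)" if "t \<le> m" for t
  proof -
    have P: "P (take t u) \<in> carrier G" "P (take t v) \<in> carrier G"
      using w take_in_words P_closed by blast+
    obtain g where g: "g \<in> words A" "length g = word_dist G \<epsilon> A (P (take t u)) (P (take t v))"
      "P g = inv\<^bsub>G\<^esub> P (take t u) \<otimes>\<^bsub>G\<^esub> P (take t v)"
      using G.word_dist_attained[OF \<epsilon> gen P] by blast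
    have "length g \<in> fellow_dists G \<epsilon> A L m"
      unfolding fellow_dists_def using g(2) uv a eq that by blast
    then have "length g \<le> ?k"
      unfolding fellow_fun_def
      using G.fellow_dists_finite[OF \<epsilon>] L by (auto simp: normal_form_def intro: Max_ge)
    then show ?thesis
      using g(1,3) P by (intro bexI[of _ g]) (simp_all flip: G.m_assoc)
  qed
  then obtain \<gamma> where \<gamma>: "\<And>t. t \<le> m \<Longrightarrow> \<gamma> t \<in> words A" "\<And>t. t \<le> m \<Longrightarrow> length (\<gamma> t) \<le> ?k"
    "\<And>t. t \<le> m \<Longrightarrow> P (take t u) \<otimes>\<^bsub>G\<^esub> P (\<gamma> t) = P (take t v)"
    by metis
  have "Q u \<otimes>\<^bsub>H\<^esub> Q (\<gamma> m) = Q v"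
    using fill_ladder[OF short n w \<gamma>, of m m] uv by simp
  moreover have "Q (\<gamma> m) = Q [Pos a]"
  proof (rule short_equations_hold[OF short])
    have "P u \<otimes>\<^bsub>G\<^esub> P (\<gamma> m) = P u \<otimes>\<^bsub>G\<^esub> \<epsilon> a"
      using \<gamma>(3)[of m] uv eq by simp
    then show "P (\<gamma> m) = P [Pos a]"
      using P_closed[OF w(1)] P_closed[OF \<gamma>(1)[of m]] \<epsilon> a by (simp add: word_val_def image_subset_iff)
  qed (use \<gamma>(1,2)[of m] n a in \<open>auto simp: letters_def\<close>)
  ultimately show ?thesis
    using \<delta> a by (simp add: word_val_def image_subset_iff)
qed

text \<open>The fellow traveler function only concerns right multiplication by a generator. For the inverse
  of a generator the two sides of the cell exchange their roles.\<close>
lemma fill_cell: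
  assumes uv: "u \<in> L" "v \<in> L" "length u \<le> m" "length v \<le> m" and x: "x \<in> letters A"
    and eq: "P u \<otimes>\<^bsub>G\<^esub> P [x] = P v"
  shows "Q u \<otimes>\<^bsub>H\<^esub> Q [x] = Q v"
proof (cases x)
  case (Pos a)
  then show ?thesis
    using fill_generator_cell[OF uv, of a] x eq G.word_val_letter[OF \<epsilon> x] H.word_val_letter[OF \<delta> x]
    by (auto simp: letters_def)
next
  case (Neg a)
  then have a: "a \<in> A" "\<epsilon> a \<in> carrier G" "\<delta> a \<in> carrier H"
    using x \<epsilon> \<delta> by (auto simp: letters_def)
  note c = P_closed[OF L_words[OF uv(1)]] Q_closed[OF L_words[OF uv(2)]]
  have "P v = P u \<otimes>\<^bsub>G\<^esub> inv\<^bsub>G\<^esub> \<epsilon> a"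
    using eq G.word_val_letter[OF \<epsilon> x] Neg by simp
  then have "P v \<otimes>\<^bsub>G\<^esub> \<epsilon> a = P u"
    using a c by (simp add: G.m_assoc)
  then have "Q v \<otimes>\<^bsub>H\<^esub> \<delta> a = Q u"
    using uv a by (intro fill_generator_cell)
  then have "Q u \<otimes>\<^bsub>H\<^esub> inv\<^bsub>H\<^esub> \<delta> a = Q v"
    using a c by (metis H.inv_closed H.m_assoc H.r_inv H.r_one)
  then show ?thesis
    using H.word_val_letter[OF \<delta> x] Neg by simp
qed

text \<open>Multiplying the cells over the successive letters of \<open>w\<close> telescopes to \<open>u 0 w = u (length w)\<close> in
  \<open>H\<close>. The outer sides are the same word, because an element of \<open>G\<close> has only one normal form.\<close>
lemma fill_relation:
  assumes w: "w \<in> words A" "P w = \<one>\<^bsub>G\<^esub>"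
    and len: "\<And>u i. u \<in> L \<Longrightarrow> i \<le> length w \<Longrightarrow> P u = P (take i w) \<Longrightarrow> length u \<le> m"
  shows "Q w = \<one>\<^bsub>H\<^esub>"
proof -
  have bij: "bij_betw P L (carrier G)"
    using L by (simp add: normal_form_def)
  define u where "u i = inv_into L P (P (take i w))" for i
  have tw: "take i w \<in> words A" for i
    using w take_in_words by blast
  have u: "u i \<in> L" "P (u i) = P (take i w)" for i
    using bij P_closed[OF tw[of i]] unfolding u_def
    by (auto simp: bij_betw_def inv_into_into f_inv_into_f)
  have fan: "Q (u 0) \<otimes>\<^bsub>H\<^esub> Q (take i w) = Q (u i)" if "i \<le> length w" for i
    using that
  proof (induction i)
    case 0
    then show ?case
      using Q_closed[OF L_words[OF u(1)]] by (simp add: word_val_def)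
  next
    case (Suc i)
    let ?x = "w ! i"
    have x: "?x \<in> letters A" "[?x] \<in> words A"
      using w Suc.prems by (auto simp: in_lists_conv_set)
    have split: "take (Suc i) w = take i w @ [?x]"
      using Suc.prems by (simp add: take_Suc_conv_app_nth)
    have "P (u i) \<otimes>\<^bsub>G\<^esub> P [?x] = P (u (Suc i))"
      unfolding u(2) split using P_append[OF tw x(2)] by simp
    then have "Q (u i) \<otimes>\<^bsub>H\<^esub> Q [?x] = Q (u (Suc i))"
      using Suc.prems by (intro fill_cell u(1) len[OF u(1) _ u(2)] x(1)) auto
    moreover have "Q (u 0) \<otimes>\<^bsub>H\<^esub> Q (take (Suc i) w) = Q (u 0) \<otimes>\<^bsub>H\<^esub> Q (take i w) \<otimes>\<^bsub>H\<^esub> Q [?x]"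
      unfolding split Q_append[OF tw x(2)]
      using Q_closed[OF L_words[OF u(1)]] Q_closed[OF tw] Q_closed[OF x(2)]
      by (simp add: H.m_assoc)
    ultimately show ?case
      using Suc by simp
  qed
  have "u (length w) = u 0"
    using w by (simp add: u_def word_val_def)
  then show ?thesis
    using fan[of "length w"] Q_closed[OF L_words[OF u(1)]] Q_closed[OF w(1)]
    by (simp add: H.r_cancel_one)
qed

end

end

text \<open>For a relation \<open>w\<close> of length \<open>n\<close>, each prefix represents an element within distance \<open>n\<close> of the
  identity, so its normal form has length at most \<open>C (n + 1)\<close>. The hypothesis \<open>small\<close> then says that
  the loops filling \<open>w\<close> are shorter than \<open>w\<close>, and induction on the length applies to them.\<close>
theorem short_relations_suffice:
  fixes G :: "('g, 'm) monoid_scheme" and H :: "('h, 'n) monoid_scheme"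
  assumes "two_marked_groups G H A \<epsilon> \<delta>" and gen: "generate G (\<epsilon> ` A) = carrier G"
    and L: "normal_form G \<epsilon> A L"
    and quasi: "\<And>w. w \<in> L \<Longrightarrow>
      real (length w) \<le> C * (real (word_dist G \<epsilon> A \<one>\<^bsub>G\<^esub> (word_val G \<epsilon> w)) + 1)"
    and C: "C > 0"
    and small: "\<And>n. n \<ge> N \<Longrightarrow> 2 * fellow_fun G \<epsilon> A L (nat \<lceil>C * (real n + 1)\<rceil>) + 2 < n"
    and short: "short_relations_hold G \<epsilon> H \<delta> A N"
    and w: "w \<in> words A" "word_val G \<epsilon> w = \<one>\<^bsub>G\<^esub>"
  shows "word_val H \<delta> w = \<one>\<^bsub>H\<^esub>"
  using w
proof (induction "length w" arbitrary: w rule: less_induct)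
  case less
  interpret two_marked_groups G H A \<epsilon> \<delta> by fact
  let ?n = "length w"
  show ?case
  proof (cases "?n < N")
    case True
    then show ?thesis
      using short less.prems by (simp add: short_relations_hold_def)
  next
    case False
    show ?thesis
    proof (rule fill_relation[OF gen L _ small[of ?n]])
      show "short_relations_hold G \<epsilon> H \<delta> A ?n"
        using less.hyps by (auto simp: short_relations_hold_def)
      show "length u \<le> nat \<lceil>C * (real ?n + 1)\<rceil>"
        if u: "u \<in> L" "i \<le> ?n" "P u = P (take i w)" for u i
      proof -
        have i: "take i w \<in> words A"
          using less.prems take_in_words by blast
        have "word_dist G \<epsilon> A \<one>\<^bsub>G\<^esub> (P u) \<le> length (take i w)"
          unfolding word_dist_def using i P_closed[OF i] u
          by (intro Least_le) (auto intro!: bexI[of _ "take i w"])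
        then have "word_dist G \<epsilon> A \<one>\<^bsub>G\<^esub> (P u) \<le> ?n"
          by simp
        then have "C * (real (word_dist G \<epsilon> A \<one>\<^bsub>G\<^esub> (P u)) + 1) \<le> C * (real ?n + 1)"
          using C by simp
        then have "real (length u) \<le> C * (real ?n + 1)"
          using quasi[OF u(1)] by linarith
        then show ?thesis
          by linarith
      qed
    qed (use False less.prems in auto)
  qed
qed

section \<open>A criterion for finite presentability\<close>

lemma (in group) word_val_free_eq:
  assumes \<epsilon>: "\<epsilon> ` X \<subseteq> carrier G" and uv: "(u, v) \<in> free_eq X"
  shows "word_val G \<epsilon> u = word_val G \<epsilon> v"
proof -
  have cancel: "word_val G \<epsilon> p = word_val G \<epsilon> q" if "(p, q) \<in> cancel X" for p q
    using that
  proof cases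
    case (1 p' q' x)
    have "word_val G \<epsilon> [x, flip x] = \<one>"
      using letter_val_closed[OF \<epsilon> 1(5)] letter_val_flip[OF \<epsilon> 1(5)] by (simp add: word_val_def)
    then have "word_val G \<epsilon> ([x, flip x] @ q') = word_val G \<epsilon> q'"
      using word_val_append[OF \<epsilon>, of "[x, flip x]" q'] word_val_closed[OF \<epsilon> 1(4)] 1 by simp
    then show ?thesis
      unfolding 1(1,2) using word_val_append[OF \<epsilon> 1(3), of "[x, flip x] @ q'"]
        word_val_append[OF \<epsilon> 1(3,4)] 1(4,5) by simp
  qed
  have "(u, v) \<in> (cancel X \<union> (cancel X)\<inverse>)\<^sup>*"
    using uv by (simp add: free_eq_def)
  then show ?thesis
    by induction (use cancel in fastforce)+
qed

text \<open>The homomorphism from the free group that extends \<open>\<epsilon>\<close>. Evaluation is constant on each class, so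
  its image on the class is a singleton.\<close>
definition lift :: "('g, 'm) monoid_scheme \<Rightarrow> ('s \<Rightarrow> 'g) \<Rightarrow> 's letter list set \<Rightarrow> 'g" where
  "lift G \<epsilon> c = the_elem (word_val G \<epsilon> ` c)"

lemma free_group_elem:
  assumes "c \<in> carrier (free_group X)"
  obtains w where "w \<in> words X" "c = free_eq X `` {w}"
  using assms by (auto simp: free_group_def quotient_def)

lemma free_group_class: "w \<in> words X \<Longrightarrow> free_eq X `` {w} \<in> carrier (free_group X)"
  by (auto simp: free_group_def quotient_def)

lemma (in group) lift_class:
  assumes \<epsilon>: "\<epsilon> ` X \<subseteq> carrier G" and w: "w \<in> words X"
  shows "lift G \<epsilon> (free_eq X `` {w}) = word_val G \<epsilon> w"
proof -
  have "w \<in> free_eq X `` {w}"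
    using w equiv_class_self[OF equiv_free_eq] by auto
  moreover have "word_val G \<epsilon> v = word_val G \<epsilon> w" if "v \<in> free_eq X `` {w}" for v
    using word_val_free_eq[OF \<epsilon>, of w v] that by simp
  ultimately have "word_val G \<epsilon> ` (free_eq X `` {w}) = {word_val G \<epsilon> w}"
    by (metis (no_types, lifting) empty_iff image_cong image_constant_conv)
  then show ?thesis
    by (simp add: lift_def)
qed

lemma (in group) lift_group_hom:
  assumes \<epsilon>: "\<epsilon> ` X \<subseteq> carrier G"
  shows "group_hom (free_group X) G (lift G \<epsilon>)"
proof (intro group_hom.intro group_hom_axioms.intro group_free_group is_group homI)
  fix c d
  assume "c \<in> carrier (free_group X)" "d \<in> carrier (free_group X)"
  then obtain u v where u: "u \<in> words X" "c = free_eq X `` {u}"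
    and v: "v \<in> words X" "d = free_eq X `` {v}"
    by (meson free_group_elem)
  then show "lift G \<epsilon> c \<in> carrier G"
    using lift_class[OF \<epsilon>] word_val_closed[OF \<epsilon>] by simp
  have "u @ v \<in> words X"
    using u v by auto
  then show "lift G \<epsilon> (c \<otimes>\<^bsub>free_group X\<^esub> d) = lift G \<epsilon> c \<otimes> lift G \<epsilon> d"
    using u v lift_class[OF \<epsilon>] word_val_append[OF \<epsilon>] by (simp add: free_group_mult)
qed

lemma (in group_hom) hom_word_val:
  assumes "\<epsilon> ` X \<subseteq> carrier G" "w \<in> words X"
  shows "h (word_val G \<epsilon> w) = word_val H (h \<circ> \<epsilon>) w"
  using assms(2)
proof (induction w)
  case Nil
  then show ?case by (simp add: word_val_def)
next
  case (Cons x w)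
  have "h (letter_val G \<epsilon> x) = letter_val H (h \<circ> \<epsilon>) x"
    using Cons.hyps assms(1) by (auto simp: letters_def)
  then show ?case
    using Cons G.letter_val_closed[OF assms(1)] G.word_val_closed[OF assms(1)]
    by (simp add: word_val_def del: o_apply) (simp add: comp_def)
qed

lemma word_val_map_letter:
  "word_val G \<epsilon> (map (map_letter f) w) = word_val G (\<epsilon> \<circ> f) w"
proof (induction w)
  case (Cons x w)
  then show ?case by (cases x) (auto simp: word_val_def)
qed (simp add: word_val_def)

lemma map_letter_words: "w \<in> words X \<Longrightarrow> map (map_letter f) w \<in> words (f ` X)"
  by (induction w) (auto simp: letters_def)

lemma word_val_free_group:
  assumes "w \<in> words X"
  shows "word_val (free_group X) (\<lambda>x. free_eq X `` {[Pos x]}) w = free_eq X `` {w}"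
  using assms
proof (induction w)
  case Nil
  then show ?case by (simp add: word_val_def free_group_def)
next
  case (Cons x w)
  interpret F: group "free_group X" by (rule group_free_group)
  have "letter_val (free_group X) (\<lambda>x. free_eq X `` {[Pos x]}) x = free_eq X `` {[x]}"
  proof (cases x)
    case (Neg a)
    then have a: "[Pos a] \<in> words X" "[Neg a] \<in> words X"
      using Cons.hyps by (auto simp: letters_def)
    have "free_eq X `` {[Neg a, Pos a]} = free_eq X `` {[]}"
      using free_eq_inverse[OF a(1)] by (intro equiv_class_eq[OF equiv_free_eq]) simp
    then have "free_eq X `` {[Neg a]} \<otimes>\<^bsub>free_group X\<^esub> free_eq X `` {[Pos a]} = \<one>\<^bsub>free_group X\<^esub>"
      unfolding free_group_mult[OF a(2,1)] by (simp add: free_group_def)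
    then show ?thesis
      using a Neg by (simp add: F.inv_equality free_group_class)
  qed simp
  then show ?case
    using Cons free_group_mult[of "[x]" X w] by (simp add: word_val_def)
qed

text \<open>Rename the symbols injectively to natural numbers and let \<open>N\<close> be the normal closure of \<open>T\<close> in the
  free group on them. It lies in the kernel of the evaluation map to \<open>G\<close>. The hypothesis, used for
  the quotient \<open>H\<close> of the free group by \<open>N\<close>, gives the converse inclusion, because a word has value
  \<open>\<one>\<close> in \<open>H\<close> exactly if its class lies in \<open>N\<close>. This is the only group \<open>H\<close> that matters, which is why
  a hypothesis about groups on one particular type is enough.\<close>
lemma finitely_presentedI:
  fixes G :: "('g, 'm) monoid_scheme" and A :: "'s set"
  assumes "group G" "finite A" and \<epsilon>: "\<epsilon> ` A \<subseteq> carrier G"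
    and gen: "generate G (\<epsilon> ` A) = carrier G"
    and T: "finite T" "T \<subseteq> {w \<in> words A. word_val G \<epsilon> w = \<one>\<^bsub>G\<^esub>}"
    and consequence: "\<And>(H :: nat letter list set set monoid) \<delta> w. group H \<Longrightarrow> \<delta> ` A \<subseteq> carrier H \<Longrightarrow>
      (\<And>v. v \<in> T \<Longrightarrow> word_val H \<delta> v = \<one>\<^bsub>H\<^esub>) \<Longrightarrow> w \<in> words A \<Longrightarrow> word_val G \<epsilon> w = \<one>\<^bsub>G\<^esub> \<Longrightarrow>
      word_val H \<delta> w = \<one>\<^bsub>H\<^esub>"
  shows "finitely_presented G"
proof -
  interpret G: group G by fact
  have T_null: "v \<in> words A" "word_val G \<epsilon> v = \<one>\<^bsub>G\<^esub>" if "v \<in> T" for v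
    using T(2) that by blast+
  obtain h :: "'s \<Rightarrow> nat" where h: "inj_on h A"
    using finite_imp_inj_to_nat_seg[OF \<open>finite A\<close>] by auto
  define X where "X = h ` A"
  define r where "r = inv_into A h"
  have r: "r ` X = A" "\<And>a. a \<in> A \<Longrightarrow> r (h a) = a"
    using h by (auto simp: r_def X_def inv_into_image_cancel)
  let ?F = "free_group X"
  interpret F: group ?F by (rule group_free_group)
  have \<epsilon>r: "(\<epsilon> \<circ> r) ` X \<subseteq> carrier G"
    using \<epsilon> r(1) by (auto simp: image_comp[symmetric])
  interpret lift: group_hom ?F G "lift G (\<epsilon> \<circ> r)"
    by (rule G.lift_group_hom[OF \<epsilon>r])
  let ?cl = "\<lambda>w. free_eq X `` {map (map_letter h) w}"
  have words_h: "map (map_letter h) w \<in> words X" if "w \<in> words A" for w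
    using map_letter_words[OF that] by (simp add: X_def)
  have words_r: "map (map_letter r) w \<in> words A" if "w \<in> words X" for w
    using map_letter_words[OF that, of r] by (simp add: r)
  have h_r: "map (map_letter h) (map (map_letter r) w) = w" if "w \<in> words X" for w
    using that
  proof (induction w)
    case (Cons x w)
    moreover have "map_letter h (map_letter r x) = x"
      using Cons.hyps by (auto simp: letters_def X_def r(2))
    ultimately show ?case by simp
  qed simp
  have lift_cl: "lift G (\<epsilon> \<circ> r) (?cl w) = word_val G \<epsilon> w" if "w \<in> words A" for w
  proof -
    have "map (map_letter r) (map (map_letter h) w) = w"
      using that
    proof (induction w)
      case (Cons x w)
      moreover have "map_letter r (map_letter h x) = x"
        using Cons.hyps by (auto simp: letters_def r(2))
      ultimately show ?case by simp
    qed simp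
    then show ?thesis
      using G.lift_class[OF \<epsilon>r words_h[OF that]] word_val_map_letter[of G \<epsilon> r] by metis
  qed
  have elem: "\<exists>w\<in>words A. c = ?cl w" if "c \<in> carrier ?F" for c
    using that words_r h_r by (metis free_group_elem)
  define R where "R = ?cl ` T"
  define N where "N = normal_closure ?F R"
  have R: "R \<subseteq> carrier ?F"
    unfolding R_def using T(2) free_group_class[OF words_h] by blast
  have "R \<subseteq> N"
    by (auto simp: N_def normal_closure_def)
  interpret N: normal N ?F
    unfolding N_def by (rule F.normal_closure_normal[OF R])
  let ?q = "\<lambda>c. N #>\<^bsub>?F\<^esub> c"
  interpret q: group_hom ?F "?F Mod N" ?q
    by (intro group_hom.intro group_hom_axioms.intro F.is_group N.factorgroup_is_group
        N.r_coset_hom_Mod)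
  define \<delta> where "\<delta> = ?q \<circ> (\<lambda>x. free_eq X `` {[Pos x]}) \<circ> h"
  have gens: "(\<lambda>x. free_eq X `` {[Pos x]}) ` X \<subseteq> carrier ?F"
    by (auto intro!: free_group_class simp: letters_def)
  have \<delta>: "\<delta> ` A \<subseteq> carrier (?F Mod N)"
    using gens q.hom_closed by (auto simp: \<delta>_def X_def)
  have val: "word_val (?F Mod N) \<delta> w = ?q (?cl w)" if "w \<in> words A" for w
    using q.hom_word_val[OF gens words_h[OF that]] word_val_free_group[OF words_h[OF that]]
    by (simp add: \<delta>_def word_val_map_letter)
  have "kernel ?F G (lift G (\<epsilon> \<circ> r)) = N"
  proof
    have "R \<subseteq> kernel ?F G (lift G (\<epsilon> \<circ> r))"
    proof
      fix c
      assume "c \<in> R"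
      then obtain v where "v \<in> T" "c = ?cl v"
        unfolding R_def by blast
      then have "lift G (\<epsilon> \<circ> r) c = \<one>\<^bsub>G\<^esub>"
        using lift_cl T_null by simp
      then show "c \<in> kernel ?F G (lift G (\<epsilon> \<circ> r))"
        using R \<open>c \<in> R\<close> by (auto simp: kernel_def)
    qed
    then show "N \<subseteq> kernel ?F G (lift G (\<epsilon> \<circ> r))"
      unfolding N_def normal_closure_def by (intro Inter_lower CollectI conjI lift.normal_kernel)
    show "kernel ?F G (lift G (\<epsilon> \<circ> r)) \<subseteq> N"
    proof
      fix c
      assume c: "c \<in> kernel ?F G (lift G (\<epsilon> \<circ> r))"
      then have c_carrier: "c \<in> carrier ?F" and c_one: "lift G (\<epsilon> \<circ> r) c = \<one>\<^bsub>G\<^esub>"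
        by (simp_all add: kernel_def)
      obtain w where w: "w \<in> words A" "c = ?cl w"
        using elem[OF c_carrier] by (elim bexE)
      have "word_val G \<epsilon> w = \<one>\<^bsub>G\<^esub>"
        using c_one lift_cl[OF w(1)] w(2) by simp
      moreover have "word_val (?F Mod N) \<delta> v = \<one>\<^bsub>?F Mod N\<^esub>" if "v \<in> T" for v
      proof -
        have "?cl v \<in> N"
          using imageI[OF that, of ?cl] \<open>R \<subseteq> N\<close> unfolding R_def by (rule rev_subsetD)
        then have "?q (?cl v) = N"
          by (rule N.rcos_const[OF F.is_group])
        then show ?thesis
          using val[OF T_null(1)[OF that]] by (simp only: FactGroup_def monoid.simps)
      qed
      ultimately have "word_val (?F Mod N) \<delta> w = \<one>\<^bsub>?F Mod N\<^esub>"
        using consequence[OF N.factorgroup_is_group \<delta> _ w(1)] by presburger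
      then have "?q c = N"
        using val[OF w(1)] w(2) by (simp only: FactGroup_def monoid.simps)
      then show "c \<in> N"
        by (rule F.coset_join1[OF _ c_carrier N.subgroup_axioms])
    qed
  qed
  moreover have "lift G (\<epsilon> \<circ> r) ` carrier ?F = carrier G"
  proof
    show "carrier G \<subseteq> lift G (\<epsilon> \<circ> r) ` carrier ?F"
    proof
      fix g
      assume "g \<in> carrier G"
      then obtain w where "w \<in> words A" "word_val G \<epsilon> w = g"
        using G.word_val_surj[OF \<epsilon> gen] by blast
      then show "g \<in> lift G (\<epsilon> \<circ> r) ` carrier ?F"
        using lift_cl free_group_class[OF words_h] by (metis imageI)
    qed
  qed (use lift.hom_closed in auto)
  ultimately have "?F Mod N \<cong> G"
    using lift.FactGroup_iso by simp
  then have "G \<cong> ?F Mod N"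
    using group.iso_sym[OF N.factorgroup_is_group] by blast
  moreover have "finite X" "finite R"
    using \<open>finite A\<close> T by (simp_all add: X_def R_def)
  ultimately show ?thesis
    unfolding finitely_presented_def N_def using R by blast
qed

section \<open>Groups without finite presentations\<close>

theorem theorem15:
  fixes G :: "('g, 'm) monoid_scheme" and A :: "'s set" and \<epsilon> :: "'s \<Rightarrow> 'g"
  assumes "group G"
    and "infinite (carrier G)"
    and "\<not> finitely_presented G"
    and "finite A"
    and "\<epsilon> ` A \<subseteq> carrier G"
    and "generate G (\<epsilon> ` A) = carrier G"
  shows "\<not> (\<exists>f\<in>growth_functions. f \<lless> (\<lambda>n. real n) \<and>
           (\<exists>L. normal_form G \<epsilon> A L \<and> quasigeodesic G \<epsilon> A L \<and> fellow_traveler G \<epsilon> A L f))"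
proof
  assume "\<exists>f\<in>growth_functions. f \<lless> (\<lambda>n. real n) \<and>
           (\<exists>L. normal_form G \<epsilon> A L \<and> quasigeodesic G \<epsilon> A L \<and> fellow_traveler G \<epsilon> A L f)"
  then obtain f L where f: "f \<in> growth_functions" "f \<lless> (\<lambda>n. real n)"
    and L: "normal_form G \<epsilon> A L" and quasi: "quasigeodesic G \<epsilon> A L"
    and fellow: "(\<lambda>n. real (fellow_fun G \<epsilon> A L n)) \<preceq> f"
    unfolding fellow_traveler_def by blast
  obtain C :: real where C: "C > 0" and len: "\<And>w. w \<in> L \<Longrightarrow>
      real (length w) \<le> C * (real (word_dist G \<epsilon> A \<one>\<^bsub>G\<^esub> (word_val G \<epsilon> w)) + 1)"
    using quasi unfolding quasigeodesic_def by blast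
  let ?m = "\<lambda>n. nat \<lceil>C * (real n + 1)\<rceil>"
  \<comment> \<open>For \<open>n \<ge> 1\<close> the bound \<open>?m n\<close> is at most \<open>(2 C + 1) n\<close>, so the slope \<open>c\<close> makes the fellow
    traveler function at most \<open>n / 4\<close> there.\<close>
  define c where "c = 1 / (4 * (2 * C + 1))"
  have "c > 0"
    using C by (simp add: c_def)
  then obtain N0 where N0: "\<And>m. m \<ge> N0 \<Longrightarrow> real (fellow_fun G \<epsilon> A L m) \<le> c * real m"
    using sublinear_if_growth_less[OF f fellow] by blast
  \<comment> \<open>The inequality \<open>2 (n / 4) + 2 < n\<close> needs \<open>n > 4\<close>; the other bound ensures \<open>?m n \<ge> N0\<close>.\<close>
  define N where "N = max 5 (nat \<lceil>real N0 / C\<rceil>)"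
  have small: "2 * fellow_fun G \<epsilon> A L (?m n) + 2 < n" if n: "n \<ge> N" for n
  proof -
    have n5: "n \<ge> 5"
      using n by (simp add: N_def)
    have "real N0 / C \<le> real n"
      using n unfolding N_def by linarith
    then have "real N0 \<le> C * real n"
      using C by (simp add: field_simps)
    also have "\<dots> \<le> C * (real n + 1)"
      using C by simp
    finally have "N0 \<le> ?m n"
      by linarith
    then have "real (fellow_fun G \<epsilon> A L (?m n)) \<le> c * real (?m n)"
      by (rule N0)
    also have "real (?m n) \<le> C * (real n + 1) + 1"
      using C by (smt (verit) mult_pos_pos of_nat_0_le_iff of_nat_ceiling of_nat_nat
          ceiling_correct zero_le_ceiling)
    also have "\<dots> \<le> (2 * C + 1) * real n"
    proof -
      have "C * 1 \<le> C * real n"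
        using n5 C by (intro mult_left_mono) auto
      then show ?thesis
        using n5 by (simp add: algebra_simps)
    qed
    also have "c * ((2 * C + 1) * real n) = real n / 4"
      using C by (simp add: c_def divide_simps)
    finally have "real (fellow_fun G \<epsilon> A L (?m n)) \<le> real n / 4"
      using \<open>c > 0\<close> by simp
    then show ?thesis
      using n5 by linarith
  qed
  define T where "T = {w \<in> words A. length w < N \<and> word_val G \<epsilon> w = \<one>\<^bsub>G\<^esub>}"
  have "finite (letters A)"
    using \<open>finite A\<close> by (simp add: letters_def)
  then have "finite {w. set w \<subseteq> letters A \<and> length w \<le> N}"
    by (rule finite_lists_length_le)
  then have "finite T"
    by (rule rev_finite_subset) (auto simp: T_def)
  have "finitely_presented G"
  proof (rule finitely_presentedI[OF assms(1,4,5,6) \<open>finite T\<close>])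
    show "T \<subseteq> {w \<in> words A. word_val G \<epsilon> w = \<one>\<^bsub>G\<^esub>}"
      by (auto simp: T_def)
  next
    fix H :: "nat letter list set set monoid" and \<delta> w
    assume H: "group H" "\<delta> ` A \<subseteq> carrier H" and "\<And>v. v \<in> T \<Longrightarrow> word_val H \<delta> v = \<one>\<^bsub>H\<^esub>"
      and w: "w \<in> words A" "word_val G \<epsilon> w = \<one>\<^bsub>G\<^esub>"
    then have "short_relations_hold G \<epsilon> H \<delta> A N"
      by (auto simp: short_relations_hold_def T_def)
    moreover have "two_marked_groups G H A \<epsilon> \<delta>"
      using assms H by (intro two_marked_groups.intro two_marked_groups_axioms.intro)
    ultimately show "word_val H \<delta> w = \<one>\<^bsub>H\<^esub>"
      using short_relations_suffice[OF _ assms(6) L len C small _ w] by blast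
  qed
  with assms(3) show False
    by contradiction
qed

end
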